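(* Let $\gimel$ be a Polish group and $E\subseteq\gimel$ a Borel set. Then $\o_B(D(\gimel,E))\le\aleph_0$ if and only if $E$ is countable.
   Context: The generalized distance graph is $D(\gimel,E)=\{\{x,y\}: xy^{-1}\in E\}$ on $\gimel$. An orientation of a graph $G$ on $X$ is a relation $o\subseteq X^2$ such that $\{x,y\}\in G$ iff $(x,y)\in o$ or $(y,x)\in o$; $\operatorname{out}_o(x)=|\{y:(x,y)\in o\}|$. $\o_B(G)=\min\{\sup_x\operatorname{out}_o(x): o\text{ a Borel orientation of } G\}$. *)

theory Defs
  imports "HOL-Analysis.Analysis"
begin

unbundle cardinal_syntax

text \<open>
  Graphs on a type are sets of unordered pairs; \<open>{x, x} = {x}\<close> is a loop. Groups of class
  \<^class>\<open>group_add\<close> need not be commutative, so \<open>x - y = x + (- y)\<close> is what is written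
  \<open>x y\<inverse>\<close> multiplicatively. Polish groups are types of sort
  \<open>{topological_group_add, polish_space}\<close>; the metric carried by
  \<^class>\<open>polish_space\<close> is only required to be complete and to induce the topology, and it
  need not be related to the group operation.
\<close>

definition distance_graph :: "'a::group_add set \<Rightarrow> 'a set set" where
  "distance_graph E = {{x, y} | x y. x - y \<in> E}"

definition is_orientation :: "'a set set \<Rightarrow> 'a rel \<Rightarrow> bool" where
  "is_orientation G r \<longleftrightarrow> (\<forall>x y. {x, y} \<in> G \<longleftrightarrow> (x, y) \<in> r \<or> (y, x) \<in> r)"

definition is_borel_orientation :: "'a::topological_space set set \<Rightarrow> 'a rel \<Rightarrow> bool" where
  "is_borel_orientation G r \<longleftrightarrow> is_orientation G r \<and> r \<in> sets borel"

text \<open>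
  Cardinal numbers are represented, as in the library, by cardinal orders (up to \<open>=o\<close>).
  All cardinals involved are at most the cardinality of the vertex type \<open>'a\<close>, so they are
  represented by relations on \<open>'a\<close>.
\<close>

definition out_degree :: "'a rel \<Rightarrow> 'a \<Rightarrow> 'a rel" where
  "out_degree r x = |{y. (x, y) \<in> r}|"

definition is_card_Sup :: "'a rel set \<Rightarrow> 'a rel \<Rightarrow> bool" where
  "is_card_Sup K s \<longleftrightarrow> Card_order s \<and> (\<forall>k\<in>K. k \<le>o s) \<and>
     (\<forall>t :: 'a rel. Card_order t \<and> (\<forall>k\<in>K. k \<le>o t) \<longrightarrow> s \<le>o t)"

definition card_Sup :: "'a rel set \<Rightarrow> 'a rel" where
  "card_Sup K = (SOME s. is_card_Sup K s)"

definition is_card_Min :: "'a rel set \<Rightarrow> 'a rel \<Rightarrow> bool" where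
  "is_card_Min K m \<longleftrightarrow> m \<in> K \<and> (\<forall>k\<in>K. m \<le>o k)"

definition card_Min :: "'a rel set \<Rightarrow> 'a rel" where
  "card_Min K = (SOME m. is_card_Min K m)"

definition borel_orientation_number :: "'a::topological_space set set \<Rightarrow> 'a rel" where
  "borel_orientation_number G =
     card_Min {card_Sup (range (out_degree r)) | r. is_borel_orientation G r}"

text \<open>The choices above are from nonempty sets:\<close>

lemma ex_least_card:
  fixes K :: "'a rel set"
  assumes "K \<noteq> {}" and "\<And>k. k \<in> K \<Longrightarrow> Card_order k"
  shows "\<exists>m. is_card_Min K m"
proof -
  have wo: "Well_order k" if "k \<in> K" for k
    using assms(2)[OF that] card_order_on_well_order_on by blast
  from assms(1) have "\<exists>m\<in>K. \<forall>k\<in>K. m \<le>o k"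
    using exists_minim_Well_order[of K] wo by blast
  then show ?thesis
    unfolding is_card_Min_def by blast
qed

lemma is_card_Sup_card_Sup:
  fixes K :: "'a rel set"
  assumes "\<And>k. k \<in> K \<Longrightarrow> Card_order k"
  shows "is_card_Sup K (card_Sup K)"
proof -
  let ?U = "{t :: 'a rel. Card_order t \<and> (\<forall>k\<in>K. k \<le>o t)}"
  have "k \<le>o |UNIV :: 'a set|" if "k \<in> K" for k
  proof -
    have "k =o |Field k|"
      using card_of_Field_ordIso[OF assms[OF that]] ordIso_symmetric by blast
    moreover have "|Field k| \<le>o |UNIV :: 'a set|"
      by (rule card_of_mono1) simp
    ultimately show ?thesis
      by (rule ordIso_ordLeq_trans)
  qed
  then have "|UNIV :: 'a set| \<in> ?U"
    using card_of_Card_order by blast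
  then obtain s where "is_card_Min ?U s"
    using ex_least_card[of ?U] by blast
  then have "is_card_Sup K s"
    unfolding is_card_Min_def is_card_Sup_def by blast
  then show ?thesis
    unfolding card_Sup_def by (rule someI)
qed

lemma is_card_Sup_out_degree:
  "is_card_Sup (range (out_degree r)) (card_Sup (range (out_degree r)))"
  by (rule is_card_Sup_card_Sup) (auto simp: out_degree_def card_of_Card_order)

lemma is_card_Min_borel_orientation_number:
  assumes "is_borel_orientation G r"
  shows "is_card_Min {card_Sup (range (out_degree r)) | r. is_borel_orientation G r}
           (borel_orientation_number G)"
proof -
  let ?K = "{card_Sup (range (out_degree r)) | r. is_borel_orientation G r}"
  have "?K \<noteq> {}"
    using assms by blast
  moreover have "Card_order k" if "k \<in> ?K" for k
    using that is_card_Sup_out_degree unfolding is_card_Sup_def by blast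
  ultimately have "\<exists>m. is_card_Min ?K m"
    by (rule ex_least_card)
  then show ?thesis
    unfolding borel_orientation_number_def card_Min_def by (rule someI_ex)
qed

lemma is_borel_orientation_distance_graph:
  fixes E :: "'a::{topological_group_add, polish_space} set"
  assumes "E \<in> sets borel"
  shows "is_borel_orientation (distance_graph E) {(x, y). x - y \<in> E}"
proof -
  have "(\<lambda>z :: 'a \<times> 'a. fst z - snd z) \<in> borel_measurable borel"
    by (intro borel_measurable_continuous_onI continuous_intros)
  then have "(\<lambda>z :: 'a \<times> 'a. fst z - snd z) -` E \<inter> space borel \<in> sets borel"
    using assms by (rule measurable_sets)
  moreover have "(\<lambda>z :: 'a \<times> 'a. fst z - snd z) -` E \<inter> space borel = {(x, y). x - y \<in> E}"
    by auto
  ultimately show ?thesis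
    unfolding is_borel_orientation_def is_orientation_def distance_graph_def
    by (auto simp: doubleton_eq_iff)
qed

end

theory Submission
  imports Defs "HOL-Library.Countable_Set_Type"
begin

text \<open>
  Suppose a Borel orientation has countable out-degrees and \<open>E\<close> is uncountable. Being a
  projection of a closed set of a Polish space, \<open>E\<close> admits a nonempty Polish space \<open>Z\<close> and a
  continuous map \<open>f : Z \<rightarrow> E\<close> with nowhere dense fibres. Split \<open>\<Gamma> \<times> Z\<close>, where \<open>\<Gamma>\<close> is the
  group, according to the direction of the edge between \<open>f z + y\<close> and \<open>y\<close>. For fixed \<open>y\<close>,
  the edges leaving \<open>y\<close> involve only countably many values \<open>f z\<close>, so by the
  Kuratowski--Ulam theorem one piece is meagre. The homeomorphism
  \<open>(y, z) \<mapsto> (f z + y, z)\<close> exchanges the roles of the end points, so the other piece is meagre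
  too, contradicting the Baire category theorem. Category replaces Haar measure, which is not
  available on a group that is not locally compact.
\<close>

section \<open>Meagre sets and the Baire property\<close>

text \<open>Covers by closed sets with empty interior feed directly into the Baire category theorem
  and make passing to subsets immediate.\<close>

definition meagre_in :: "'a topology \<Rightarrow> 'a set \<Rightarrow> bool" where
  "meagre_in X A \<longleftrightarrow>
     (\<exists>\<G>. countable \<G> \<and> (\<forall>T\<in>\<G>. closedin X T \<and> X interior_of T = {}) \<and> A \<subseteq> \<Union>\<G>)"

definition baire_property_in :: "'a topology \<Rightarrow> 'a set \<Rightarrow> bool" where
  "baire_property_in X A \<longleftrightarrow> (\<exists>U. openin X U \<and> meagre_in X (A - U \<union> (U - A)))"

lemma meagre_in_subset: "meagre_in X B \<Longrightarrow> A \<subseteq> B \<Longrightarrow> meagre_in X A"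
  unfolding meagre_in_def using subset_trans by metis

lemma meagre_in_empty: "meagre_in X {}"
  unfolding meagre_in_def by (rule exI[of _ "{}"]) simp

lemma meagre_in_nowhere_dense: "closedin X T \<Longrightarrow> X interior_of T = {} \<Longrightarrow> meagre_in X T"
  unfolding meagre_in_def by (rule exI[of _ "{T}"]) simp

lemma meagre_in_UN:
  assumes "countable I" "\<And>i. i \<in> I \<Longrightarrow> meagre_in X (A i)"
  shows "meagre_in X (\<Union>i\<in>I. A i)"
proof -
  have "\<forall>i\<in>I. \<exists>\<G>. countable \<G> \<and> (\<forall>T\<in>\<G>. closedin X T \<and> X interior_of T = {}) \<and> A i \<subseteq> \<Union>\<G>"
    using assms(2) unfolding meagre_in_def by blast
  then obtain \<G> where \<G>: "\<forall>i\<in>I. countable (\<G> i) \<and>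
      (\<forall>T\<in>\<G> i. closedin X T \<and> X interior_of T = {}) \<and> A i \<subseteq> \<Union>(\<G> i)"
    by metis
  show ?thesis
    unfolding meagre_in_def
  proof (intro exI conjI)
    show "countable (\<Union>i\<in>I. \<G> i)"
      using assms(1) \<G> by blast
    show "\<forall>T\<in>\<Union>i\<in>I. \<G> i. closedin X T \<and> X interior_of T = {}"
      using \<G> by simp
    have "A i \<subseteq> \<Union>(\<Union>i\<in>I. \<G> i)" if "i \<in> I" for i
    proof -
      have "A i \<subseteq> \<Union>(\<G> i)"
        using \<G> that by simp
      also have "\<dots> \<subseteq> \<Union>(\<Union>i\<in>I. \<G> i)"
        using that by (intro Union_mono UN_upper)
      finally show ?thesis .
    qed
    then show "(\<Union>i\<in>I. A i) \<subseteq> \<Union>(\<Union>i\<in>I. \<G> i)"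
      by (rule UN_least)
  qed
qed

lemma meagre_in_Un:
  assumes "meagre_in X A" "meagre_in X B"
  shows "meagre_in X (A \<union> B)"
  using meagre_in_UN[of "{A, B}" X "\<lambda>S. S"] assms by auto

lemma meagre_in_homeomorphic_image:
  assumes "homeomorphic_map X Y f" "meagre_in X A"
  shows "meagre_in Y (f ` A)"
proof -
  obtain \<G> where \<G>: "countable \<G>" "\<And>T. T \<in> \<G> \<Longrightarrow> closedin X T \<and> X interior_of T = {}"
      "A \<subseteq> \<Union>\<G>"
    using assms(2) unfolding meagre_in_def by blast
  have "closedin Y (f ` T) \<and> Y interior_of (f ` T) = {}" if "T \<in> \<G>" for T
    using \<G>(2)[OF that] homeomorphic_map_closedness_eq[OF assms(1), of T]
      homeomorphic_map_interior_of[OF assms(1), of T] closedin_subset by fastforce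
  moreover have "f ` A \<subseteq> \<Union>((`) f ` \<G>)"
    using image_mono[OF \<G>(3), of f] by (simp add: image_Union)
  ultimately show ?thesis
    unfolding meagre_in_def using \<G>(1)
    by (intro exI[of _ "(`) f ` \<G>"] conjI ballI) auto
qed

text \<open>By the Baire category theorem, the union of a countable family of closed nowhere dense
  sets has empty interior; an open set covered by the family lies in that interior.\<close>

lemma openin_meagre_in_imp_empty:
  assumes "completely_metrizable_space X" "openin X U" "meagre_in X U"
  shows "U = {}"
proof -
  obtain \<G> where "countable \<G>" "\<And>T. T \<in> \<G> \<Longrightarrow> closedin X T \<and> X interior_of T = {}"
      "U \<subseteq> \<Union>\<G>"
    using assms(3) unfolding meagre_in_def by blast
  then show ?thesis
    using Baire_category_alt[of X \<G>] assms(1,2) interior_of_maximal[of U "\<Union>\<G>" X] by blast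
qed

lemma baire_property_in_openin: "openin X U \<Longrightarrow> baire_property_in X U"
  unfolding baire_property_in_def by (intro exI[of _ U]) (simp add: meagre_in_empty)

lemma baire_property_in_compl:
  assumes "baire_property_in X A"
  shows "baire_property_in X (topspace X - A)"
proof -
  obtain U where U: "openin X U" "meagre_in X (A - U \<union> (U - A))"
    using assms unfolding baire_property_in_def by blast
  define C where "C = topspace X - U"
  have C: "closedin X C"
    unfolding C_def using U(1) by blast
  \<comment> \<open>The boundary of the closed set \<open>C\<close> is nowhere dense, so the
    interior of \<open>C\<close> can serve as the open approximation of the complement of
    \<open>A\<close>.\<close>
  let ?B = "C - X interior_of C"
  have "meagre_in X ?B"
  proof (rule meagre_in_nowhere_dense)
    show "closedin X ?B"
      using C by (intro closedin_diff) auto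
    show "X interior_of ?B = {}"
      unfolding interior_of_eq_empty
    proof (intro allI impI)
      fix T assume T: "openin X T \<and> T \<subseteq> ?B"
      then have "T \<subseteq> X interior_of C"
        by (intro interior_of_maximal) auto
      with T show "T = {}"
        by blast
    qed
  qed
  then have "meagre_in X ((A - U \<union> (U - A)) \<union> ?B)"
    using U(2) by (rule meagre_in_Un[rotated])
  then have "meagre_in X ((topspace X - A) - X interior_of C \<union> (X interior_of C - (topspace X - A)))"
    by (rule meagre_in_subset) (use interior_of_subset[of X C] in \<open>auto simp: C_def\<close>)
  then show ?thesis
    unfolding baire_property_in_def using openin_interior_of by blast
qed

lemma baire_property_in_UN:
  assumes "\<And>n::nat. baire_property_in X (A n)"
  shows "baire_property_in X (\<Union>n. A n)"
proof -
  obtain U where U: "\<And>n. openin X (U n)" "\<And>n. meagre_in X (A n - U n \<union> (U n - A n))"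
    using assms unfolding baire_property_in_def by metis
  have "meagre_in X (\<Union>n. A n - U n \<union> (U n - A n))"
    using U(2) by (intro meagre_in_UN) auto
  then have "meagre_in X ((\<Union>n. A n) - (\<Union>n. U n) \<union> ((\<Union>n. U n) - (\<Union>n. A n)))"
    by (rule meagre_in_subset) auto
  moreover have "openin X (\<Union>n. U n)"
    using U(1) by blast
  ultimately show ?thesis
    unfolding baire_property_in_def by blast
qed

text \<open>The sets whose preimage has the Baire property form a sigma-algebra containing the open
  sets. The preimage form lets a Borel relation on the group be pulled back to another
  space.\<close>

lemma baire_property_in_borel_vimage:
  assumes f: "continuous_map X euclidean f" and B: "B \<in> sets borel"
  shows "baire_property_in X {x \<in> topspace X. f x \<in> B}"
proof -
  have "B \<in> sigma_sets UNIV {S. open S}"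
    using B unfolding borel_def by simp
  then show ?thesis
  proof induction
    case (Basic S)
    then have "openin X {x \<in> topspace X. f x \<in> S}"
      using openin_continuous_map_preimage[OF f] by simp
    then show ?case
      by (rule baire_property_in_openin)
  next
    case Empty
    then show ?case
      by (simp add: baire_property_in_openin)
  next
    case (Compl S)
    have "{x \<in> topspace X. f x \<in> UNIV - S} = topspace X - {x \<in> topspace X. f x \<in> S}"
      by auto
    then show ?case
      using baire_property_in_compl[OF Compl.IH] by simp
  next
    case (Union S)
    have "{x \<in> topspace X. f x \<in> (\<Union>n. S n)} = (\<Union>n. {x \<in> topspace X. f x \<in> S n})"
      by auto
    then show ?case
      using baire_property_in_UN[OF Union.IH] by simp
  qed
qed

section \<open>The Kuratowski--Ulam theorem\<close>

lemma closedin_section: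
  assumes "closedin (prod_topology X Y) F" "x \<in> topspace X"
  shows "closedin Y {y. (x, y) \<in> F}"
proof -
  have "continuous_map Y (prod_topology X Y) (\<lambda>y. (x, y))"
    using assms(2) by (intro continuous_intros) auto
  then have "closedin Y {y \<in> topspace Y. (x, y) \<in> F}"
    using assms(1) by (rule closedin_continuous_map_preimage)
  moreover have "{y \<in> topspace Y. (x, y) \<in> F} = {y. (x, y) \<in> F}"
    using closedin_subset[OF assms(1)] by auto
  ultimately show ?thesis
    by simp
qed

text \<open>A section of \<open>F\<close> is closed, so a nonmeagre section contains a nonempty
  basic open set \<open>V\<close>, and its base point lies in \<open>A V\<close>. An open
  \<open>T\<close> inside \<open>A V\<close> would put the open box \<open>T \<times> V\<close>
  inside \<open>F\<close>. Hence each \<open>A V\<close> is closed and nowhere dense, and there are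
  only countably many.\<close>

lemma kuratowski_ulam_nowhere_dense:
  assumes Y: "second_countable Y"
    and F: "closedin (prod_topology X Y) F" "prod_topology X Y interior_of F = {}"
  shows "meagre_in X {x \<in> topspace X. \<not> meagre_in Y {y. (x, y) \<in> F}}"
proof -
  obtain \<B> where \<B>: "countable \<B>" "\<And>V. V \<in> \<B> \<Longrightarrow> openin Y V"
      "\<And>U y. openin Y U \<Longrightarrow> y \<in> U \<Longrightarrow> \<exists>V\<in>\<B>. y \<in> V \<and> V \<subseteq> U"
    using Y unfolding second_countable_def by metis
  define A where "A V = {x \<in> topspace X. \<forall>y\<in>V. (x, y) \<in> F}" for V
  \<comment> \<open>The empty set is excluded because \<open>A {}\<close> is all of
    \<open>topspace X\<close>.\<close>
  have "meagre_in X (A V)" if V: "V \<in> \<B> - {{}}" for V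
  proof (rule meagre_in_nowhere_dense)
    have VY: "V \<subseteq> topspace Y"
      using V \<B>(2) openin_subset by blast
    have "closedin X {x \<in> topspace X. (x, y) \<in> F}" if "y \<in> V" for y
    proof (rule closedin_continuous_map_preimage[OF _ F(1)])
      show "continuous_map X (prod_topology X Y) (\<lambda>x. (x, y))"
        using that VY by (intro continuous_intros) auto
    qed
    then have "closedin X (\<Inter>y\<in>V. {x \<in> topspace X. (x, y) \<in> F})"
      using V by (intro closedin_Inter) auto
    moreover have "(\<Inter>y\<in>V. {x \<in> topspace X. (x, y) \<in> F}) = A V"
      unfolding A_def using V by auto
    ultimately show "closedin X (A V)"
      by simp
    show "X interior_of (A V) = {}"
      unfolding interior_of_eq_empty
    proof (intro allI impI)
      fix T assume T: "openin X T \<and> T \<subseteq> A V"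
      then have "openin (prod_topology X Y) (T \<times> V)"
        using V \<B>(2) by (simp add: openin_prod_Times_iff)
      moreover have "T \<times> V \<subseteq> F"
        using T unfolding A_def by auto
      ultimately have "T \<times> V = {}"
        using F(2) unfolding interior_of_eq_empty by blast
      then show "T = {}"
        using V by auto
    qed
  qed
  then have "meagre_in X (\<Union>V\<in>\<B> - {{}}. A V)"
    using \<B>(1) by (intro meagre_in_UN) auto
  moreover have "x \<in> (\<Union>V\<in>\<B> - {{}}. A V)"
    if x: "x \<in> topspace X" "\<not> meagre_in Y {y. (x, y) \<in> F}" for x
  proof -
    have "Y interior_of {y. (x, y) \<in> F} \<noteq> {}"
      using x closedin_section[OF F(1) x(1)] meagre_in_nowhere_dense by blast
    then obtain T where T: "openin Y T" "T \<subseteq> {y. (x, y) \<in> F}" "T \<noteq> {}"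
      unfolding interior_of_eq_empty by blast
    then obtain y V where "V \<in> \<B>" "y \<in> V" "V \<subseteq> T"
      using \<B>(3) by blast
    then show ?thesis
      using T x(1) unfolding A_def by blast
  qed
  ultimately show ?thesis
    by (elim meagre_in_subset) blast
qed

lemma kuratowski_ulam_meagre:
  assumes Y: "second_countable Y" and M: "meagre_in (prod_topology X Y) M"
  shows "meagre_in X {x \<in> topspace X. \<not> meagre_in Y {y. (x, y) \<in> M}}"
proof -
  obtain \<G> where \<G>: "countable \<G>"
      "\<And>T. T \<in> \<G> \<Longrightarrow> closedin (prod_topology X Y) T \<and> prod_topology X Y interior_of T = {}"
      "M \<subseteq> \<Union>\<G>"
    using M unfolding meagre_in_def by blast
  have "meagre_in X (\<Union>T\<in>\<G>. {x \<in> topspace X. \<not> meagre_in Y {y. (x, y) \<in> T}})"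
    using \<G>(1,2) by (intro meagre_in_UN kuratowski_ulam_nowhere_dense Y) auto
  moreover have "\<exists>T\<in>\<G>. \<not> meagre_in Y {y. (x, y) \<in> T}"
    if "\<not> meagre_in Y {y. (x, y) \<in> M}" for x
  proof (rule ccontr)
    assume "\<not> ?thesis"
    then have "meagre_in Y (\<Union>T\<in>\<G>. {y. (x, y) \<in> T})"
      using \<G>(1) by (intro meagre_in_UN) auto
    then have "meagre_in Y {y. (x, y) \<in> M}"
      by (rule meagre_in_subset) (use \<G>(3) in auto)
    with that show False ..
  qed
  ultimately show ?thesis
    by (elim meagre_in_subset) auto
qed

text \<open>A nonempty open \<open>U\<close> approximating \<open>S\<close> would contain a nonempty
  open box \<open>A \<times> B\<close>. Since \<open>A\<close> is not meagre, at some
  \<open>a\<close> in \<open>A\<close> the sections of \<open>S\<close> and \<open>U\<close> differ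
  by a meagre set. The section of \<open>S\<close> being meagre, so is \<open>B\<close>, against
  Baire category. With \<open>U\<close> empty, the approximation error is \<open>S\<close>
  itself.\<close>

lemma meagre_in_prod_if_sections_meagre:
  assumes X: "completely_metrizable_space X"
    and Y: "completely_metrizable_space Y" "second_countable Y"
    and S: "baire_property_in (prod_topology X Y) S"
    and sections: "\<And>x. x \<in> topspace X \<Longrightarrow> meagre_in Y {y. (x, y) \<in> S}"
  shows "meagre_in (prod_topology X Y) S"
proof -
  obtain U where U: "openin (prod_topology X Y) U"
      and M: "meagre_in (prod_topology X Y) (S - U \<union> (U - S))"
    using S unfolding baire_property_in_def by blast
  have "U = {}"
  proof (rule ccontr)
    assume "U \<noteq> {}"
    then obtain x y where "(x, y) \<in> U"
      by auto
    then obtain A B where AB: "openin X A" "openin Y B" "x \<in> A" "y \<in> B" "A \<times> B \<subseteq> U"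
      using U unfolding openin_prod_topology_alt by metis
    have "\<not> meagre_in X A"
      using openin_meagre_in_imp_empty[OF X] AB by blast
    then have "\<not> A \<subseteq> {x \<in> topspace X. \<not> meagre_in Y {y. (x, y) \<in> S - U \<union> (U - S)}}"
      using kuratowski_ulam_meagre[OF Y(2) M] meagre_in_subset by blast
    then obtain a where a: "a \<in> A" "a \<in> topspace X"
        "meagre_in Y {y. (a, y) \<in> S - U \<union> (U - S)}"
      using openin_subset[OF AB(1)] by blast
    then have "meagre_in Y ({y. (a, y) \<in> S} \<union> {y. (a, y) \<in> S - U \<union> (U - S)})"
      using sections meagre_in_Un by blast
    then have "meagre_in Y B"
      by (rule meagre_in_subset) (use AB a in auto)
    then show False
      using openin_meagre_in_imp_empty[OF Y(1)] AB by blast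
  qed
  then show ?thesis
    using M by simp
qed

section \<open>Borel sets as projections of closed sets\<close>

text \<open>Over a Polish space these are the analytic sets, with
  \<open>nat \<Rightarrow> nat\<close> as the Baire space. The closed set \<open>C\<close> is itself
  Polish then, and \<open>fst\<close> maps it continuously onto \<open>A\<close>.\<close>

definition suslin :: "'a::topological_space set \<Rightarrow> bool" where
  "suslin A \<longleftrightarrow> (\<exists>C :: ('a \<times> (nat \<Rightarrow> nat)) set. closed C \<and> A = fst ` C)"

lemma suslin_closed: "closed A \<Longrightarrow> suslin A"
  unfolding suslin_def by (intro exI[of _ "A \<times> UNIV"] conjI closed_Times) simp_all

lemma suslin_UN:
  fixes A :: "nat \<Rightarrow> 'a::topological_space set"
  assumes "\<And>n. suslin (A n)"
  shows "suslin (\<Union>n. A n)"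
proof -
  obtain C :: "nat \<Rightarrow> ('a \<times> (nat \<Rightarrow> nat)) set"
    where C: "\<And>n. closed (C n)" "\<And>n. A n = fst ` C n"
    using assms unfolding suslin_def by metis
  let ?p = "\<lambda>(x, s). (x, \<lambda>i. s (Suc i)) :: 'a \<times> (nat \<Rightarrow> nat)"
  \<comment> \<open>The zeroth entry of the sequence selects the index \<open>n\<close>.\<close>
  define D where "D = (\<Inter>n. (\<lambda>z. snd z 0) -` (- {n}) \<union> ?p -` C n)"
  have p: "continuous_on UNIV ?p"
    unfolding case_prod_unfold
    by (intro continuous_intros continuous_on_product_then_coordinatewise)
  have "closed ((\<lambda>z :: 'a \<times> (nat \<Rightarrow> nat). snd z 0) -` (- {n}))" for n
  proof (rule closed_vimage)
    show "continuous_on UNIV (\<lambda>z :: 'a \<times> (nat \<Rightarrow> nat). snd z 0)"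
      by (rule continuous_on_product_then_coordinatewise) (rule continuous_on_snd[OF continuous_on_id])
  qed (simp add: closed_def open_discrete)
  then have "closed D"
    unfolding D_def by (intro closed_INT ballI closed_Un closed_vimage[OF C(1) p])
  moreover have "fst ` D = (\<Union>n. A n)"
  proof (intro equalityI subsetI)
    fix x assume "x \<in> fst ` D"
    then obtain s where "(x, s) \<in> D"
      by auto
    then have "(x, \<lambda>i. s (Suc i)) \<in> C (s 0)"
      unfolding D_def by auto
    then have "x \<in> A (s 0)"
      unfolding C(2) by (rule image_eqI[of _ fst, rotated]) simp
    then show "x \<in> (\<Union>n. A n)"
      by blast
  next
    fix x assume "x \<in> (\<Union>n. A n)"
    then obtain n where "x \<in> A n"
      by blast
    then obtain s where "(x, s) \<in> C n"
      unfolding C(2) by auto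
    then have "(x, case_nat n s) \<in> D"
      unfolding D_def by auto
    then show "x \<in> fst ` D"
      by force
  qed
  ultimately show ?thesis
    unfolding suslin_def by blast
qed

text \<open>One sequence carries witnesses for all \<open>A n\<close> at once: its row with index
  \<open>n\<close>, read through \<open>prod_encode\<close>, is the witness for
  \<open>A n\<close>.\<close>

lemma suslin_INT:
  fixes A :: "nat \<Rightarrow> 'a::topological_space set"
  assumes "\<And>n. suslin (A n)"
  shows "suslin (\<Inter>n. A n)"
proof -
  obtain C :: "nat \<Rightarrow> ('a \<times> (nat \<Rightarrow> nat)) set"
    where C: "\<And>n. closed (C n)" "\<And>n. A n = fst ` C n"
    using assms unfolding suslin_def by metis
  let ?p = "\<lambda>n (x, s). (x, \<lambda>i. s (prod_encode (n, i))) :: 'a \<times> (nat \<Rightarrow> nat)"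
  define D where "D = (\<Inter>n. ?p n -` C n)"
  have p: "continuous_on UNIV (?p n)" for n
    unfolding case_prod_unfold
    by (intro continuous_intros continuous_on_product_then_coordinatewise)
  have "closed D"
    unfolding D_def by (intro closed_INT ballI closed_vimage[OF C(1) p])
  moreover have "fst ` D = (\<Inter>n. A n)"
  proof (intro equalityI subsetI)
    fix x assume "x \<in> fst ` D"
    then obtain s where "(x, s) \<in> D"
      by auto
    then have "(x, \<lambda>i. s (prod_encode (n, i))) \<in> C n" for n
      unfolding D_def by auto
    then have "x \<in> A n" for n
      unfolding C(2) by (rule image_eqI[of _ fst, rotated]) simp
    then show "x \<in> (\<Inter>n. A n)"
      by (rule INT_I)
  next
    fix x assume "x \<in> (\<Inter>n. A n)"
    then have "x \<in> A n" for n
      by (rule INT_D) simp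
    then have "\<exists>s. (x, s) \<in> C n" for n
      unfolding C(2) image_iff by (metis prod.collapse)
    then obtain s where "\<And>n. (x, s n) \<in> C n"
      by metis
    then have "(x, \<lambda>k. case prod_decode k of (n, i) \<Rightarrow> s n i) \<in> D"
      unfolding D_def by auto
    then show "x \<in> fst ` D"
      by force
  qed
  ultimately show ?thesis
    unfolding suslin_def by blast
qed

lemma suslin_open:
  fixes A :: "'a::metric_space set"
  assumes "open A"
  shows "suslin A"
proof -
  have "fsigma_in euclidean A"
    using assms by (intro open_imp_fsigma_in) (auto simp: metrizable_space_euclidean)
  then obtain F :: "nat \<Rightarrow> 'a set" where "\<And>n. closedin euclidean (F n)" "\<Union>(range F) = A"
    unfolding fsigma_in_ascending by blast
  then show ?thesis
    using suslin_UN[of F] suslin_closed unfolding closed_closedin by blast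
qed

lemma suslin_borel:
  fixes A :: "'a::metric_space set"
  assumes "A \<in> sets borel"
  shows "suslin A"
proof -
  have "A \<in> sigma_sets UNIV {S. open S}"
    using assms unfolding borel_def by simp
  \<comment> \<open>Suslin sets need not be closed under complements, so the induction carries a set
    together with its complement; the complement case only swaps the two.\<close>
  then have "suslin A \<and> suslin (- A)"
  proof induction
    case (Basic S)
    then show ?case
      using suslin_open[of S] suslin_closed[of "- S"] by auto
  next
    case Empty
    show ?case
      by (simp add: suslin_closed)
  next
    case (Compl S)
    then show ?case
      by (simp add: Compl_eq_Diff_UNIV[symmetric])
  next
    case (Union S)
    have "- (\<Union>n. S n) = (\<Inter>n. - S n)"
      by (rule Compl_UN)
    then show ?case
      using suslin_UN[of S] suslin_INT[of "\<lambda>n. - S n"] Union.IH by metis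
  qed
  then show ?thesis ..
qed

text \<open>Removing from a closed set that projects onto \<open>E\<close> every basic open set with countable
  projection leaves fibres without interior.\<close>

lemma ex_closed_nowhere_dense_fibres:
  fixes E :: "'a::{metric_space, second_countable_topology} set"
  assumes "E \<in> sets borel" "uncountable E"
  obtains Z :: "('a \<times> (nat \<Rightarrow> nat)) set"
  where "closed Z" "Z \<noteq> {}" "fst ` Z \<subseteq> E"
    "\<And>p. top_of_set Z interior_of {z \<in> Z. fst z = p} = {}"
proof -
  obtain C :: "('a \<times> (nat \<Rightarrow> nat)) set" where C: "closed C" "E = fst ` C"
    using suslin_borel[OF assms(1)] unfolding suslin_def by blast
  obtain \<B> :: "('a \<times> (nat \<Rightarrow> nat)) set set" where \<B>: "countable \<B>" "topological_basis \<B>"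
    using ex_countable_basis by blast
  define \<N> where "\<N> = {b \<in> \<B>. countable (fst ` (C \<inter> b))}"
  define Z where "Z = C - \<Union>\<N>"
  have small: "countable (fst ` (C \<inter> \<Union>\<N>))"
  proof -
    have "countable (\<Union>b\<in>\<N>. fst ` (C \<inter> b))"
      using \<B>(1) unfolding \<N>_def by (intro countable_UN) auto
    then show ?thesis
      by (rule countable_subset[rotated]) auto
  qed
  have "open (\<Union>\<N>)"
    using \<B>(2) unfolding \<N>_def by (auto intro: topological_basis_open)
  then have "closed Z"
    unfolding Z_def using C(1) by (intro closed_Diff)
  moreover have "Z \<noteq> {}"
  proof
    assume "Z = {}"
    then have "C \<inter> \<Union>\<N> = C"
      unfolding Z_def by auto
    then show False
      using small C(2) assms(2) by simp
  qed
  moreover have "fst ` Z \<subseteq> E"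
    unfolding Z_def C(2) by auto
  moreover have "top_of_set Z interior_of {z \<in> Z. fst z = p} = {}" for p
    unfolding interior_of_eq_empty
  proof (intro allI impI, rule ccontr)
    fix T assume T: "openin (top_of_set Z) T \<and> T \<subseteq> {z \<in> Z. fst z = p}" "T \<noteq> {}"
    then obtain O' z where O': "open O'" "T = Z \<inter> O'" "z \<in> T"
      by (auto simp: openin_open)
    then obtain b where b: "b \<in> \<B>" "z \<in> b" "b \<subseteq> O'"
      using topological_basisE[OF \<B>(2), of O' z] by blast
    \<comment> \<open>A point of \<open>C \<inter> b\<close> either was removed, and then projects
      into the countable set of \<open>small\<close>, or lies in \<open>Z \<inter> O' = T\<close>,
      and then projects to \<open>p\<close>. So \<open>b\<close> should have been removed, although
      it contains the point \<open>z\<close> of \<open>Z\<close>.\<close>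
    have "fst ` (C \<inter> b) \<subseteq> insert p (fst ` (C \<inter> \<Union>\<N>))"
    proof
      fix x assume "x \<in> fst ` (C \<inter> b)"
      then obtain w where w: "w \<in> C" "w \<in> b" "x = fst w"
        by auto
      show "x \<in> insert p (fst ` (C \<inter> \<Union>\<N>))"
      proof (cases "w \<in> \<Union>\<N>")
        case False
        then have "w \<in> T"
          using w b O' unfolding Z_def by auto
        then show ?thesis
          using T(1) w by auto
      qed (use w in auto)
    qed
    moreover have "countable (insert p (fst ` (C \<inter> \<Union>\<N>)))"
      using small by (rule countable_insert)
    ultimately have "countable (fst ` (C \<inter> b))"
      by (rule countable_subset)
    then have "b \<in> \<N>"
      unfolding \<N>_def using b(1) by simp
    then show False
      using b(2) O' unfolding Z_def by auto
  qed
  ultimately show thesis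
    using that by blast
qed

section \<open>Complete metrizability and second countability of the underlying spaces\<close>

lemma completely_metrizable_space_baire_space:
  "completely_metrizable_space (euclidean :: (nat \<Rightarrow> nat) topology)"
proof -
  have "(euclidean :: nat topology) = discrete_topology UNIV"
    by (simp add: topology_eq open_discrete)
  then have "completely_metrizable_space (euclidean :: nat topology)"
    by (simp only: completely_metrizable_space_discrete_topology)
  then show ?thesis
    unfolding euclidean_product_topology[symmetric] completely_metrizable_space_product_topology
    by (intro disjI2 conjI ballI countableI_type)
qed

lemma second_countable_euclidean:
  "second_countable (euclidean :: 'a::second_countable_topology topology)"
proof -
  obtain \<B> :: "'a set set" where \<B>: "countable \<B>" "topological_basis \<B>"
    using ex_countable_basis by blast
  have "\<exists>V\<in>\<B>. x \<in> V \<and> V \<subseteq> U" if "open U" "x \<in> U" for U x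
    by (rule topological_basisE[OF \<B>(2) that]) auto
  moreover have "open V" if "V \<in> \<B>" for V
    using \<B>(2) that by (rule topological_basis_open)
  ultimately show ?thesis
    unfolding second_countable_def open_openin[symmetric] using \<B>(1) by blast
qed

section \<open>Orientations with countable out-degrees\<close>

lemma countable_if_countable_out_sections:
  fixes E :: "'a::{topological_group_add, polish_space} set"
  assumes E: "E \<in> sets borel"
    and r: "is_borel_orientation (distance_graph E) r"
    and out: "\<And>x. countable {y. (x, y) \<in> r}"
  shows "countable E"
proof (rule ccontr)
  assume "uncountable E"
  then obtain Z :: "('a \<times> (nat \<Rightarrow> nat)) set" where Z: "closed Z" "Z \<noteq> {}" "fst ` Z \<subseteq> E"
    and fibres: "\<And>p. top_of_set Z interior_of {z \<in> Z. fst z = p} = {}"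
    by (rule ex_closed_nowhere_dense_fibres[OF E]) (rule that)
  let ?X = "euclidean :: 'a topology" and ?Y = "top_of_set Z"
  define W where "W = prod_topology ?X ?Y"
  \<comment> \<open>The product form serves the Kuratowski--Ulam theorem, the subspace form serves
    continuity arguments.\<close>
  have W_eq: "W = top_of_set (UNIV \<times> Z)"
    unfolding W_def using prod_topology_subtopology_eu[of UNIV Z] unfolding subtopology_UNIV .
  have topW: "topspace W = UNIV \<times> Z"
    unfolding W_eq by simp
  have X: "completely_metrizable_space ?X"
    by (rule completely_metrizable_space_euclidean)
  have "completely_metrizable_space (prod_topology ?X (euclidean :: (nat \<Rightarrow> nat) topology))"
    using X completely_metrizable_space_baire_space
    by (simp only: completely_metrizable_space_prod_topology simp_thms)
  then have Y: "completely_metrizable_space ?Y"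
    using Z(1) by (intro completely_metrizable_space_closedin) auto
  have Y2: "second_countable ?Y"
    by (intro second_countable_subtopology second_countable_euclidean)
  have W: "completely_metrizable_space W"
    unfolding W_def completely_metrizable_space_prod_topology using X Y by blast

  have fibre_meagre: "meagre_in ?Y {z \<in> Z. fst z \<in> P}" if "countable P" for P
  proof -
    have "meagre_in ?Y {z \<in> Z. fst z = p}" for p
    proof (rule meagre_in_nowhere_dense[OF _ fibres])
      have "closed (fst -` {p} :: ('a \<times> (nat \<Rightarrow> nat)) set)"
        by (intro closed_vimage continuous_intros)
      moreover have "{z \<in> Z. fst z = p} = Z \<inter> fst -` {p}"
        by auto
      ultimately show "closedin ?Y {z \<in> Z. fst z = p}"
        unfolding closedin_closed by blast
    qed
    then have "meagre_in ?Y (\<Union>p\<in>P. {z \<in> Z. fst z = p})"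
      using that by (intro meagre_in_UN) auto
    then show ?thesis
      by (rule meagre_in_subset) auto
  qed

  \<comment> \<open>\<open>g\<close> abstracts the two ways of turning a point of \<open>W\<close>
    into an ordered pair. Over a fixed \<open>x\<close>, the selected \<open>z\<close> lie in
    countably many fibres of \<open>fst\<close>, each nowhere dense.\<close>
  have meagre: "meagre_in W {w \<in> UNIV \<times> Z. g w \<in> r}"
    if g: "continuous_on UNIV g" and sec: "\<And>x. countable {fst z | z. g (x, z) \<in> r}"
    for g :: "'a \<times> 'a \<times> (nat \<Rightarrow> nat) \<Rightarrow> 'a \<times> 'a"
  proof -
    have "continuous_map W euclidean g"
      unfolding W_eq using g continuous_on_subset by auto
    then have "baire_property_in W {w \<in> UNIV \<times> Z. g w \<in> r}"
      using baire_property_in_borel_vimage[of W g r] r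
      unfolding topW is_borel_orientation_def by blast
    moreover have "meagre_in ?Y {z. (x, z) \<in> {w \<in> UNIV \<times> Z. g w \<in> r}}" for x
      by (rule meagre_in_subset[OF fibre_meagre[OF sec[of x]]]) auto
    ultimately show ?thesis
      unfolding W_def using X Y Y2 by (intro meagre_in_prod_if_sections_meagre)
  qed

  \<comment> \<open>Put \<open>x = fst z + y\<close>. \<open>T\<close> uses the coordinates
    \<open>(y, z)\<close> and collects the edges leaving \<open>y\<close>; \<open>S\<close> uses
    \<open>(x, z)\<close> and collects those leaving \<open>x\<close>. In both, the first coordinate
    is the tail, so \<open>out\<close> applies to the sections.\<close>
  define T where "T = {w \<in> UNIV \<times> Z. (\<lambda>(y, z). (y, fst z + y)) w \<in> r}"
  define S where "S = {w \<in> UNIV \<times> Z. (\<lambda>(x, z). (x, - fst z + x)) w \<in> r}"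
  \<comment> \<open>\<open>h\<close> changes the coordinate \<open>x\<close> into \<open>y\<close>,
    and \<open>k\<close> is its inverse.\<close>
  define h where "h = (\<lambda>(x, z). (- fst z + x, z) :: 'a \<times> 'a \<times> (nat \<Rightarrow> nat))"
  define k where "k = (\<lambda>(y, z). (fst z + y, z) :: 'a \<times> 'a \<times> (nat \<Rightarrow> nat))"

  have "meagre_in W T"
    unfolding T_def
  proof (rule meagre)
    show "continuous_on UNIV (\<lambda>(y, z :: 'a \<times> (nat \<Rightarrow> nat)). (y, fst z + y))"
      unfolding case_prod_unfold by (intro continuous_intros)
    fix y
    \<comment> \<open>The value \<open>fst z\<close> is recovered from the out-neighbour of
      \<open>y\<close> by subtracting \<open>y\<close> on the right.\<close>
    have "{fst z | z :: 'a \<times> (nat \<Rightarrow> nat). (case (y, z) of (y, z) \<Rightarrow> (y, fst z + y)) \<in> r}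
        \<subseteq> (\<lambda>x. x - y) ` {x. (y, x) \<in> r}"
      by (force simp: image_iff)
    then show "countable {fst z | z :: 'a \<times> (nat \<Rightarrow> nat). (case (y, z) of (y, z) \<Rightarrow> (y, fst z + y)) \<in> r}"
      by (rule countable_subset) (rule countable_image[OF out])
  qed
  moreover have "meagre_in W S"
    unfolding S_def
  proof (rule meagre)
    show "continuous_on UNIV (\<lambda>(x, z :: 'a \<times> (nat \<Rightarrow> nat)). (x, - fst z + x))"
      unfolding case_prod_unfold by (intro continuous_intros)
    fix x
    have "{fst z | z :: 'a \<times> (nat \<Rightarrow> nat). (case (x, z) of (x, z) \<Rightarrow> (x, - fst z + x)) \<in> r}
        \<subseteq> (\<lambda>y. x - y) ` {y. (x, y) \<in> r}"
      by (force simp: image_iff diff_conv_add_uminus minus_add simp del: add_uminus_conv_diff)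
    then show "countable {fst z | z :: 'a \<times> (nat \<Rightarrow> nat). (case (x, z) of (x, z) \<Rightarrow> (x, - fst z + x)) \<in> r}"
      by (rule countable_subset) (rule countable_image[OF out])
  qed
  then have "meagre_in W (h ` S)"
  proof (rule meagre_in_homeomorphic_image[rotated])
    have "continuous_on (UNIV \<times> Z) h" "continuous_on (UNIV \<times> Z) k"
      unfolding h_def k_def case_prod_unfold by (intro continuous_intros)+
    then have "homeomorphic_maps W W h k"
      unfolding homeomorphic_maps_def W_eq
      by (auto simp: h_def k_def add.assoc[symmetric])
    then show "homeomorphic_map W W h"
      by (simp add: homeomorphic_maps_map)
  qed
  ultimately have "meagre_in W (T \<union> h ` S)"
    by (rule meagre_in_Un)
  moreover have "topspace W \<subseteq> T \<union> h ` S"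
  proof
    fix w assume "w \<in> topspace W"
    then obtain y z where w: "w = (y, z)" "z \<in> Z"
      unfolding topW by auto
    \<comment> \<open>Every point of \<open>W\<close> gives an edge, because \<open>Z\<close>
      projects into \<open>E\<close>; each edge has at least one direction, so the two pieces cover
      \<open>W\<close>.\<close>
    have "(fst z + y) - y \<in> E"
      using Z(3) w(2) by auto
    then have "{fst z + y, y} \<in> distance_graph E"
      unfolding distance_graph_def by blast
    then have "(fst z + y, y) \<in> r \<or> (y, fst z + y) \<in> r"
      using r unfolding is_borel_orientation_def is_orientation_def by blast
    then show "w \<in> T \<union> h ` S"
    proof
      assume "(fst z + y, y) \<in> r"
      then have "k w \<in> S"
        unfolding S_def k_def using w by (auto simp: add.assoc[symmetric])
      moreover have "h (k w) = w"
        unfolding h_def k_def w by (simp add: add.assoc[symmetric])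
      ultimately show ?thesis
        by (metis UnI2 imageI)
    next
      assume "(y, fst z + y) \<in> r"
      then show ?thesis
        unfolding T_def using w by auto
    qed
  qed
  ultimately have "meagre_in W (topspace W)"
    by (rule meagre_in_subset)
  then have "topspace W = {}"
    using openin_meagre_in_imp_empty[OF W] by blast
  then show False
    using Z(2) unfolding topW by auto
qed

section \<open>From cardinal suprema to countability of out-neighbourhoods\<close>

lemma card_Sup_le_natLeq_iff:
  fixes K :: "'a rel set"
  assumes K: "\<And>k. k \<in> K \<Longrightarrow> Card_order k"
  shows "card_Sup K \<le>o natLeq \<longleftrightarrow> (\<forall>k\<in>K. k \<le>o natLeq)"
proof
  have sup: "is_card_Sup K (card_Sup K)"
    using K by (rule is_card_Sup_card_Sup)
  show "\<forall>k\<in>K. k \<le>o natLeq" if "card_Sup K \<le>o natLeq"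
    using sup that ordLeq_transitive unfolding is_card_Sup_def by blast
  \<comment> \<open>\<open>natLeq\<close> is a relation on \<open>nat\<close>, whereas the supremum
    is least only among bounds on \<open>'a\<close>. A countably infinite subset \<open>A\<close>
    provides a bound of the right type; if \<open>'a\<close> is countable, the cardinal of the whole
    type does.\<close>
  show "card_Sup K \<le>o natLeq" if le: "\<forall>k\<in>K. k \<le>o natLeq"
  proof (cases "countable (UNIV :: 'a set)")
    case True
    have "k \<le>o |UNIV :: 'a set|" if "k \<in> K" for k
      using K[OF that] card_of_Field_ordIso[of k] card_of_mono1[of "Field k" UNIV]
        ordIso_symmetric ordIso_ordLeq_trans by blast
    then have "card_Sup K \<le>o |UNIV :: 'a set|"
      using sup card_of_Card_order unfolding is_card_Sup_def by blast
    then show ?thesis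
      using True unfolding countable_card_le_natLeq by (rule ordLeq_transitive)
  next
    case False
    then have "infinite (UNIV :: 'a set)"
      using countable_finite by blast
    then obtain A :: "'a set" where A: "countable A" "infinite A"
      using infinite_countable_subset' by blast
    then have "natLeq \<le>o |A|"
      using infinite_iff_natLeq_ordLeq by blast
    then have "\<forall>k\<in>K. k \<le>o |A|"
      using le ordLeq_transitive by blast
    then have "card_Sup K \<le>o |A|"
      using sup card_of_Card_order unfolding is_card_Sup_def by blast
    then show ?thesis
      using A(1) unfolding countable_card_le_natLeq by (rule ordLeq_transitive)
  qed
qed

lemma card_Sup_out_degree_le_natLeq_iff:
  "card_Sup (range (out_degree r)) \<le>o natLeq \<longleftrightarrow> (\<forall>x. countable {y. (x, y) \<in> r})"
  by (subst card_Sup_le_natLeq_iff)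
     (auto simp: out_degree_def card_of_Card_order countable_card_le_natLeq)

theorem mainTheorem10:
  fixes E :: "'a::{topological_group_add, polish_space} set"
  assumes "E \<in> sets borel"
  shows "borel_orientation_number (distance_graph E) \<le>o natLeq \<longleftrightarrow> countable E"
proof -
  let ?r = "{(x, y). x - y \<in> E}"
  have "is_card_Min {card_Sup (range (out_degree r)) | r. is_borel_orientation (distance_graph E) r}
      (borel_orientation_number (distance_graph E))"
    using is_borel_orientation_distance_graph[OF assms]
    by (rule is_card_Min_borel_orientation_number)
  \<comment> \<open>The minimum is attained, so bounding it means finding one Borel orientation with
    that bound.\<close>
  then have "borel_orientation_number (distance_graph E) \<le>o natLeq \<longleftrightarrow>
      (\<exists>r. is_borel_orientation (distance_graph E) r \<and>
           card_Sup (range (out_degree r)) \<le>o natLeq)"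
    unfolding is_card_Min_def using ordLeq_transitive by (smt (verit) mem_Collect_eq)
  also have "\<dots> \<longleftrightarrow> (\<exists>r. is_borel_orientation (distance_graph E) r \<and>
      (\<forall>x. countable {y. (x, y) \<in> r}))"
    by (simp add: card_Sup_out_degree_le_natLeq_iff)
  also have "\<dots> \<longleftrightarrow> countable E"
  proof
    assume "countable E"
    then have "countable ((\<lambda>e. - e + x) ` E)" for x
      by (rule countable_image)
    \<comment> \<open>Solving \<open>x - y = e\<close> for \<open>y\<close> gives
      \<open>- e + x\<close>, in this order since the group need not be commutative.\<close>
    moreover have "{y. (x, y) \<in> ?r} \<subseteq> (\<lambda>e. - e + x) ` E" for x
    proof
      fix y assume "y \<in> {y. (x, y) \<in> ?r}"
      then have "x - y \<in> E" "y = - (x - y) + x"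
        by (auto simp: minus_diff_eq)
      then show "y \<in> (\<lambda>e. - e + x) ` E"
        by blast
    qed
    ultimately have "countable {y. (x, y) \<in> ?r}" for x
      by (rule countable_subset[rotated])
    then show "\<exists>r. is_borel_orientation (distance_graph E) r \<and> (\<forall>x. countable {y. (x, y) \<in> r})"
      using is_borel_orientation_distance_graph[OF assms] by blast
  qed (use countable_if_countable_out_sections[OF assms] in blast)
  finally show ?thesis .
qed

end
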